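(* Let $K$ be a skew field, $n$ a positive integer, and $R := \mathcal{M}_n(K)$ the ring of $n$-by-$n$ matrices over $K$. Every singular matrix $A \in R$ factors as a product of at most $\mathrm{ht}(A)$ idempotent matrices of rank $n-1$, where $\mathrm{ht}(\cdot)$ is the $\mathrm{r.Fix}_R$-height of $R^\#$.
   Context: A matrix $A \in R$ is singular if it is a (left and right) zero divisor of $R$. $R^\#$ is the multiplicative submonoid of $R$ consisting of the identity $1_R$ and all (two-sided) zero divisors of $R$. For $A \in R$, $\mathrm{r.Fix}(A) := \{X \in R : AX = X\}$. The $\mathrm{r.Fix}_R$-preorder on $R^\#$ is defined by $B \preceq C$ iff $\mathrm{r.Fix}(C) \subseteq \mathrm{r.Fix}(B)$; write $B \prec C$ if $B \preceq C$ and $C \not\preceq B$. The $\mathrm{r.Fix}_R$-non-units of $R^\#$ are the elements of $R^\#$ other than $1_R$. The $\mathrm{r.Fix}_R$-height $\mathrm{ht}(A)$ of $A \in R^\#$ is the supremum of all integers $m \ge 1$ for which there are $\mathrm{r.Fix}_R$-non-units $A_1, \ldots, A_m \in R^\#$ with $A_1 = A$ and $A_{k+1} \prec A_k$ for $1 \le k \le m-1$, with $\sup \emptyset := 0$. *)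

theory Defs
  imports "HOL-Analysis.Analysis"
begin

text \<open>
  The library's spans, dimension and matrix rank assume a commutative field of scalars. Over a
  skew field the columns of a matrix live in a right vector space, because the columns of
  \<open>A ** X\<close> are the right linear combinations of the columns of \<open>A\<close>. The definition of
  \<open>right_dim\<close> follows that of \<open>dim\<close> for vector spaces.
\<close>

definition right_scale :: "'a::division_ring ^ 'm \<Rightarrow> 'a \<Rightarrow> 'a ^ 'm"
  where "right_scale v c = (\<chi> i. v $ i * c)"

definition right_span :: "('a::division_ring ^ 'm) set \<Rightarrow> ('a ^ 'm) set"
  where "right_span S =
    {(\<Sum>v\<in>T. right_scale v (c v)) | T c. finite T \<and> T \<subseteq> S}"

definition right_independent :: "('a::division_ring ^ 'm) set \<Rightarrow> bool"
  where "right_independent S \<longleftrightarrow>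
    (\<forall>T c. finite T \<and> T \<subseteq> S \<and> (\<Sum>v\<in>T. right_scale v (c v)) = 0 \<longrightarrow> (\<forall>v\<in>T. c v = 0))"

definition right_dim :: "('a::division_ring ^ 'm) set \<Rightarrow> nat"
  where "right_dim S =
    (if \<exists>B. right_independent B \<and> right_span B = right_span S
     then card (SOME B. right_independent B \<and> right_span B = right_span S) else 0)"

definition matrix_rank :: "'a::division_ring ^ 'n ^ 'm \<Rightarrow> nat"
  where "matrix_rank A = right_dim (columns A)"

definition idempotent_matrix :: "'a::division_ring ^ 'n ^ 'n \<Rightarrow> bool"
  where "idempotent_matrix E \<longleftrightarrow> E ** E = E"

definition left_zero_divisor :: "'a::division_ring ^ 'n ^ 'n \<Rightarrow> bool"
  where "left_zero_divisor A \<longleftrightarrow> (\<exists>B :: 'a ^ 'n ^ 'n. B \<noteq> 0 \<and> A ** B = 0)"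

definition right_zero_divisor :: "'a::division_ring ^ 'n ^ 'n \<Rightarrow> bool"
  where "right_zero_divisor A \<longleftrightarrow> (\<exists>B :: 'a ^ 'n ^ 'n. B \<noteq> 0 \<and> B ** A = 0)"

definition singular_matrix :: "'a::division_ring ^ 'n ^ 'n \<Rightarrow> bool"
  where "singular_matrix A \<longleftrightarrow> left_zero_divisor A \<and> right_zero_divisor A"

definition R_sharp :: "('a::division_ring ^ 'n ^ 'n) set"
  where "R_sharp = {mat 1} \<union> {A. left_zero_divisor A \<and> right_zero_divisor A}"

definition r_Fix :: "'a::division_ring ^ 'n ^ 'n \<Rightarrow> ('a ^ 'n ^ 'n) set"
  where "r_Fix A = {X. A ** X = X}"

definition r_Fix_le :: "'a::division_ring ^ 'n ^ 'n \<Rightarrow> 'a ^ 'n ^ 'n \<Rightarrow> bool"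
  where "r_Fix_le B C \<longleftrightarrow> r_Fix C \<subseteq> r_Fix B"

definition r_Fix_less :: "'a::division_ring ^ 'n ^ 'n \<Rightarrow> 'a ^ 'n ^ 'n \<Rightarrow> bool"
  where "r_Fix_less B C \<longleftrightarrow> r_Fix_le B C \<and> \<not> r_Fix_le C B"

definition r_Fix_nonunits :: "('a::division_ring ^ 'n ^ 'n) set"
  where "r_Fix_nonunits = R_sharp - {mat 1}"

text \<open>In \<^typ>\<open>enat\<close> the supremum of the empty set is \<open>0\<close>.\<close>

definition r_Fix_height :: "'a::division_ring ^ 'n ^ 'n \<Rightarrow> enat"
  where "r_Fix_height A =
    Sup {enat m | m. 1 \<le> m \<and>
      (\<exists>C :: nat \<Rightarrow> 'a ^ 'n ^ 'n.
         (\<forall>k\<in>{1..m}. C k \<in> r_Fix_nonunits) \<and> C 1 = A \<and>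
         (\<forall>k\<in>{1..<m}. r_Fix_less (C (k + 1)) (C k)))}"

definition matrix_prod_list :: "('a::division_ring ^ 'n ^ 'n) list \<Rightarrow> 'a ^ 'n ^ 'n"
  where "matrix_prod_list Es = foldr (**) Es (mat 1)"

end

theory Submission
  imports Defs
begin

text \<open>
  A singular \<open>A\<close> that is not itself an idempotent of corank one is written as \<open>A = A' E\<close> with \<open>E\<close>
  idempotent of corank one and \<open>A'\<close> singular with a strictly larger fixed space. The matrices
  \<open>A, A', A'', \<dots>\<close> then form a descending chain for the preorder, as long as the factorization, so
  the height bounds the number of factors without being computed. The process stops because
  the fixed spaces grow inside a finite-dimensional space.

  For the factorization take \<open>u \<noteq> 0\<close> with \<open>A u = 0\<close>, a functional \<open>\<phi> = \<theta> (1 - A)\<close> with \<open>\<phi> u = 1\<close>,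
  and \<open>E = 1 - u \<phi>\<close>. Then \<open>A = (A + w \<phi>) E\<close> for every \<open>w\<close> as \<open>A u = 0\<close>, and \<open>A + w \<phi>\<close> fixes
  whatever \<open>A\<close> fixes as \<open>\<phi>\<close> vanishes there. With \<open>w = x - A x\<close> and \<open>\<phi> x = 1\<close> it also
  fixes \<open>x\<close>, which \<open>A\<close> does not. If \<open>A\<close> is not idempotent, \<open>x\<close> can be chosen as \<open>A y\<close>, which keeps
  \<open>A + w \<phi> = A (1 + (y - x) \<phi>)\<close> singular; if \<open>A\<close> is idempotent, \<open>x = u\<close> makes \<open>A + w \<phi>\<close> idempotent.
\<close>

section \<open>Arithmetic of right scalar multiplication\<close>

lemma right_scale_algebra:
  fixes v w :: "'a::division_ring ^ 'm"
  shows "right_scale (v + w) c = right_scale v c + right_scale w c"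
    and "right_scale (v - w) c = right_scale v c - right_scale w c"
    and "right_scale v (c + d) = right_scale v c + right_scale v d"
    and "right_scale v (c - d) = right_scale v c - right_scale v d"
    and "right_scale (right_scale v c) d = right_scale v (c * d)"
    and "right_scale v (- c) = - right_scale v c"
  by (simp_all add: right_scale_def vec_eq_iff algebra_simps)

lemma right_scale_simps [simp]:
  "right_scale v 1 = v" "right_scale v 0 = 0" "right_scale 0 c = 0"
  by (simp_all add: right_scale_def vec_eq_iff)

lemma right_scale_sum: "right_scale (sum f T) c = (\<Sum>v\<in>T. right_scale (f v) c)"
  by (simp add: right_scale_def vec_eq_iff sum_distrib_right)

section \<open>Dimension over a skew field\<close>

lemma right_span_iff_finite:
  assumes "finite S"
  shows "x \<in> right_span S \<longleftrightarrow> (\<exists>c. x = (\<Sum>v\<in>S. right_scale v (c v)))"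
proof
  assume "x \<in> right_span S"
  then obtain T c where T: "finite T" "T \<subseteq> S" "x = (\<Sum>v\<in>T. right_scale v (c v))"
    by (auto simp: right_span_def)
  have "x = (\<Sum>v\<in>S. right_scale v (if v \<in> T then c v else 0))"
    unfolding T(3) by (rule sum.mono_neutral_cong_left) (use assms T in auto)
  then show "\<exists>c. x = (\<Sum>v\<in>S. right_scale v (c v))"
    by (rule exI[of _ "\<lambda>v. if v \<in> T then c v else 0"])
qed (use assms in \<open>auto simp: right_span_def\<close>)

lemma right_span_mono: "S \<subseteq> T \<Longrightarrow> right_span S \<subseteq> right_span T"
  by (fastforce simp: right_span_def)

lemma right_span_finite_subset:
  assumes "x \<in> right_span S"
  obtains T where "finite T" "T \<subseteq> S" "x \<in> right_span T"
  using assms by (fastforce simp: right_span_def)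

lemma right_span_base: "x \<in> S \<Longrightarrow> x \<in> right_span S"
  unfolding right_span_def by (rule CollectI, rule exI[of _ "{x}"], rule exI[of _ "\<lambda>_. 1"]) simp

lemma right_span_zero: "0 \<in> right_span S"
  unfolding right_span_def by (rule CollectI, rule exI[of _ "{}"]) simp

lemma right_span_scale:
  assumes "x \<in> right_span S" shows "right_scale x k \<in> right_span S"
proof -
  obtain T c where T: "finite T" "T \<subseteq> S" "x = (\<Sum>v\<in>T. right_scale v (c v))"
    using assms by (auto simp: right_span_def)
  have "right_scale x k = (\<Sum>v\<in>T. right_scale v (c v * k))"
    by (simp add: T(3) right_scale_sum right_scale_algebra)
  then show ?thesis using T(1,2) by (force simp: right_span_def)
qed

lemma right_span_add:
  assumes "x \<in> right_span S" "y \<in> right_span S" shows "x + y \<in> right_span S"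
proof -
  obtain T U where TU: "finite T" "T \<subseteq> S" "x \<in> right_span T" "finite U" "U \<subseteq> S" "y \<in> right_span U"
    using assms by (meson right_span_finite_subset)
  then have "x \<in> right_span (T \<union> U)" "y \<in> right_span (T \<union> U)"
    using right_span_mono by blast+
  then obtain c d where "x = (\<Sum>v\<in>T \<union> U. right_scale v (c v))" "y = (\<Sum>v\<in>T \<union> U. right_scale v (d v))"
    using TU by (auto simp: right_span_iff_finite)
  then have "x + y = (\<Sum>v\<in>T \<union> U. right_scale v (c v + d v))"
    by (simp add: right_scale_algebra sum.distrib)
  then have "x + y \<in> right_span (T \<union> U)"
    using TU by (subst right_span_iff_finite) auto
  then show ?thesis using right_span_mono[of "T \<union> U" S] TU by blast
qed

lemma right_span_diff:
  assumes "x \<in> right_span S" "y \<in> right_span S" shows "x - y \<in> right_span S"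
  using right_span_add[OF assms(1) right_span_scale[OF assms(2), of "-1"]]
  by (simp add: right_scale_algebra)

text \<open>Serves as the induction rule for spans: a property of all vectors in a span follows by
  taking for \<open>V\<close> the set of vectors that have it.\<close>

lemma right_span_minimal:
  assumes "S \<subseteq> V" "0 \<in> V" "\<And>x y. x \<in> V \<Longrightarrow> y \<in> V \<Longrightarrow> x + y \<in> V"
    and "\<And>x k. x \<in> V \<Longrightarrow> right_scale x k \<in> V"
  shows "right_span S \<subseteq> V"
proof
  fix x assume "x \<in> right_span S"
  then obtain T c where T: "finite T" "T \<subseteq> S" "x = (\<Sum>v\<in>T. right_scale v (c v))"
    by (auto simp: right_span_def)
  from T(1,2) have "(\<Sum>v\<in>T. right_scale v (c v)) \<in> V"
    by (induction T) (use assms in auto)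
  then show "x \<in> V" using T(3) by simp
qed

lemma right_span_subset_span: "S \<subseteq> right_span T \<Longrightarrow> right_span S \<subseteq> right_span T"
  by (rule right_span_minimal) (auto intro: right_span_zero right_span_add right_span_scale)

text \<open>The vectors congruent to a right multiple of \<open>a\<close> modulo
  \<open>right_span S\<close> form a right subspace containing \<open>a\<close> and
  \<open>S\<close>.\<close>

lemma right_span_insertD:
  assumes "x \<in> right_span (insert a S)"
  obtains k where "x - right_scale a k \<in> right_span S"
proof -
  have "right_span (insert a S) \<subseteq> {x. \<exists>k. x - right_scale a k \<in> right_span S}"
  proof (rule right_span_minimal)
    show "insert a S \<subseteq> {x. \<exists>k. x - right_scale a k \<in> right_span S}"
    proof (intro subsetI CollectI)
      fix x assume "x \<in> insert a S"
      then have "x - right_scale a (if x = a then 1 else 0) \<in> right_span S"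
        by (auto intro: right_span_zero right_span_base)
      then show "\<exists>k. x - right_scale a k \<in> right_span S" ..
    qed
    show "0 \<in> {x. \<exists>k. x - right_scale a k \<in> right_span S}"
      using right_span_zero[of S] by (auto intro!: exI[of _ 0])
  next
    fix x y assume "x \<in> {x. \<exists>k. x - right_scale a k \<in> right_span S}"
      and "y \<in> {x. \<exists>k. x - right_scale a k \<in> right_span S}"
    then obtain k l where "x - right_scale a k \<in> right_span S" "y - right_scale a l \<in> right_span S"
      by blast
    from right_span_add[OF this] have "(x + y) - right_scale a (k + l) \<in> right_span S"
      by (simp add: right_scale_algebra algebra_simps)
    then show "x + y \<in> {x. \<exists>k. x - right_scale a k \<in> right_span S}" by blast
  next
    fix x m assume "x \<in> {x. \<exists>k. x - right_scale a k \<in> right_span S}"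
    then obtain k where "x - right_scale a k \<in> right_span S" by blast
    from right_span_scale[OF this, of m] have "right_scale x m - right_scale a (k * m) \<in> right_span S"
      by (simp add: right_scale_algebra)
    then show "right_scale x m \<in> {x. \<exists>k. x - right_scale a k \<in> right_span S}" by blast
  qed
  then show ?thesis using assms that by blast
qed

text \<open>Modulo the span of \<open>S\<close>, \<open>a\<close> is \<open>b\<close> times a scalar
  \<open>k\<close>. This \<open>k\<close> is nonzero since \<open>a\<close> is not in that span, so
  multiplying by \<open>inverse k\<close> on the right recovers \<open>b\<close>.\<close>

lemma right_span_exchange:
  assumes "a \<in> right_span (insert b S)" "a \<notin> right_span S"
  shows "b \<in> right_span (insert a S)"
proof -
  obtain k where k: "a - right_scale b k \<in> right_span S"
    using assms(1) by (rule right_span_insertD)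
  with assms(2) have "k \<noteq> 0" by auto
  have "a - right_scale b k \<in> right_span (insert a S)"
    using k right_span_mono[of S "insert a S"] by blast
  then have "a - (a - right_scale b k) \<in> right_span (insert a S)"
    by (rule right_span_diff[OF right_span_base[OF insertI1]])
  then have "right_scale b k \<in> right_span (insert a S)" by simp
  then have "right_scale (right_scale b k) (inverse k) \<in> right_span (insert a S)"
    by (rule right_span_scale)
  then show ?thesis using \<open>k \<noteq> 0\<close> by (simp add: right_scale_algebra)
qed

section \<open>Right independence, exchange and bases\<close>

lemma right_independent_mono: "right_independent S \<Longrightarrow> T \<subseteq> S \<Longrightarrow> right_independent T"
  unfolding right_independent_def by blast

lemma right_independent_not_in_span:
  assumes "right_independent (insert a S)" "a \<notin> S"
  shows "a \<notin> right_span S"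
proof
  assume "a \<in> right_span S"
  then obtain T c where T: "finite T" "T \<subseteq> S" "a = (\<Sum>v\<in>T. right_scale v (c v))"
    by (auto simp: right_span_def)
  have "a \<notin> T" using T assms by auto
  \<comment> \<open>The expansion of \<open>a\<close> turns into a nontrivial relation once
    \<open>a\<close> itself gets the coefficient \<open>- 1\<close>.\<close>
  then have "(\<Sum>v\<in>insert a T. right_scale v (if v = a then - 1 else c v))
      = - a + (\<Sum>v\<in>T. right_scale v (if v = a then - 1 else c v))"
    using T(1) by (simp add: right_scale_algebra)
  also have "(\<Sum>v\<in>T. right_scale v (if v = a then - 1 else c v)) = a"
    unfolding T(3) by (rule sum.cong) (use \<open>a \<notin> T\<close> T(3) in auto)
  finally have "(\<Sum>v\<in>insert a T. right_scale v (if v = a then - 1 else c v)) = 0" by simp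
  moreover have "finite (insert a T)" "insert a T \<subseteq> insert a S" using T by auto
  ultimately have "\<forall>v\<in>insert a T. (if v = a then - 1 else c v) = 0"
    using assms(1)[unfolded right_independent_def,
        THEN spec[of _ "insert a T"], THEN spec[of _ "\<lambda>v. if v = a then - 1 else c v"]]
    by blast
  then show False by simp
qed

lemma right_independent_insert:
  assumes "right_independent S" "a \<notin> right_span S"
  shows "right_independent (insert a S)"
  unfolding right_independent_def
proof (intro allI impI, elim conjE)
  fix T c assume T: "finite T" "T \<subseteq> insert a S" and s: "(\<Sum>v\<in>T. right_scale v (c v)) = 0"
  define U where "U = T - {a}"
  have U: "finite U" "U \<subseteq> S" using T by (auto simp: U_def)
  show "\<forall>v\<in>T. c v = 0"
  proof (cases "a \<in> T")
    case True
    have eq: "right_scale a (c a) + (\<Sum>v\<in>U. right_scale v (c v)) = 0"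
      using s True T(1) by (simp add: U_def sum.remove)
    have sU: "(\<Sum>v\<in>U. right_scale v (c v)) \<in> right_span S"
      using U by (auto simp: right_span_def)
    \<comment> \<open>A nonzero coefficient at \<open>a\<close> could be inverted, which would put
      \<open>a\<close> into the span of \<open>S\<close>.\<close>
    have "c a = 0"
    proof (rule ccontr)
      assume "c a \<noteq> 0"
      have "right_scale a (c a) = 0 - (\<Sum>v\<in>U. right_scale v (c v))"
        using eq by (simp add: eq_neg_iff_add_eq_0)
      then have "right_scale a (c a) \<in> right_span S"
        using right_span_diff[OF right_span_zero sU] by simp
      then have "right_scale (right_scale a (c a)) (inverse (c a)) \<in> right_span S"
        by (rule right_span_scale)
      then show False using \<open>c a \<noteq> 0\<close> assms(2) by (simp add: right_scale_algebra)
    qed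
    then have "\<forall>v\<in>U. c v = 0"
      using eq U assms(1) unfolding right_independent_def by simp
    then show ?thesis using \<open>c a = 0\<close> by (auto simp: U_def)
  next
    case False
    then show ?thesis using T s assms(1) unfolding right_independent_def by blast
  qed
qed

text \<open>\<open>U\<close> starts as \<open>T\<close>. The elements of \<open>S\<close> are
  brought in one at a time; one not yet in \<open>U\<close> replaces an element outside the part of
  \<open>S\<close> already absorbed, so \<open>U\<close> never grows and still spans
  \<open>T\<close>.\<close>

lemma right_steinitz_exchange:
  assumes "finite S" "right_independent S" "finite T" "S \<subseteq> right_span T"
  shows "\<exists>U. finite U \<and> card U \<le> card T \<and> S \<subseteq> U \<and> T \<subseteq> right_span U"
  using assms(1,2,4)
proof (induction S)
  case empty
  then show ?case using assms(3) by (auto intro!: exI[of _ T] right_span_base)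
next
  case (insert s S)
  obtain U where U: "finite U" "card U \<le> card T" "S \<subseteq> U" "T \<subseteq> right_span U"
    using insert.IH insert.prems right_independent_mono by blast
  show ?case
  proof (cases "s \<in> U")
    case True
    then show ?thesis using U by blast
  next
    case False
    have "s \<in> right_span U"
      using insert.prems(2) right_span_subset_span[OF U(4)] by blast
    \<comment> \<open>A smallest \<open>W\<close> between \<open>S\<close> and \<open>U\<close>
      whose span contains \<open>s\<close> has some \<open>t\<close> outside \<open>S\<close>. By
      minimality \<open>s\<close> is lost when \<open>t\<close> is dropped, so exchange lets
      \<open>s\<close> replace \<open>t\<close>.\<close>
    then obtain W where W: "S \<subseteq> W \<and> W \<subseteq> U \<and> s \<in> right_span W"
      and Wmin: "\<And>W'. S \<subseteq> W' \<and> W' \<subseteq> U \<and> s \<in> right_span W' \<Longrightarrow> card W \<le> card W'"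
      using ex_has_least_nat[of "\<lambda>W. S \<subseteq> W \<and> W \<subseteq> U \<and> s \<in> right_span W" U card] U(3) by blast
    have "s \<notin> right_span S"
      using right_independent_not_in_span insert.prems(1) insert.hyps(2) by blast
    with W have "W \<noteq> S" by blast
    with W obtain t where t: "t \<in> W" "t \<notin> S" by blast
    have finW: "finite W" using W U(1) finite_subset by blast
    have "s \<notin> right_span (W - {t})"
    proof
      assume "s \<in> right_span (W - {t})"
      then have "card W \<le> card (W - {t})" using W t by (intro Wmin) auto
      then show False using card_Diff1_less[OF finW t(1)] by simp
    qed
    moreover have "insert t (W - {t}) = W" using t by blast
    ultimately have "t \<in> right_span (insert s (W - {t}))"
      using W right_span_exchange by metis
    then have "t \<in> right_span (insert s (U - {t}))"
      using right_span_mono[of "insert s (W - {t})" "insert s (U - {t})"] W by blast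
    then have "U \<subseteq> right_span (insert s (U - {t}))"
      by (auto intro: right_span_base)
    then have "T \<subseteq> right_span (insert s (U - {t}))"
      using U(4) right_span_subset_span by blast
    moreover have "card (insert s (U - {t})) = card U"
    proof -
      have "t \<in> U" using t W by blast
      from card_Suc_Diff1[OF U(1) this] show ?thesis using U(1) False by simp
    qed
    moreover have "insert s S \<subseteq> insert s (U - {t})" using U t by blast
    ultimately show ?thesis using U by (intro exI[of _ "insert s (U - {t})"]) auto
  qed
qed

lemma right_independent_card_le:
  assumes "right_independent S" "finite T" "S \<subseteq> right_span T"
  shows "finite S" "card S \<le> card T"
proof -
  \<comment> \<open>Finite subsets come first: an infinite \<open>S\<close> would contain one with
    \<open>Suc (card T)\<close> elements.\<close>
  have le: "card S' \<le> card T" if "finite S'" "S' \<subseteq> S" for S'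
    using right_steinitz_exchange[of S' T] right_independent_mono[OF assms(1) that(2)] assms that
    by (meson card_mono le_trans subset_trans)
  show "finite S"
  proof (rule ccontr)
    assume "infinite S"
    then obtain S' where "finite S'" "S' \<subseteq> S" "card S' = Suc (card T)"
      by (meson infinite_arbitrarily_large)
    with le show False by force
  qed
  with le show "card S \<le> card T" by blast
qed

text \<open>An independent subset of greatest cardinality spans, since any vector of
  \<open>S\<close> outside its span could be adjoined.\<close>

lemma right_basis_exists:
  assumes "finite S"
  obtains B where "right_independent B" "B \<subseteq> S" "right_span B = right_span S"
proof -
  have "right_independent {}" by (simp add: right_independent_def)
  moreover have "\<And>B. right_independent B \<and> B \<subseteq> S \<Longrightarrow> card B < Suc (card S)"
    using assms by (simp add: card_mono less_Suc_eq_le)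
  ultimately obtain B where B: "right_independent B" "B \<subseteq> S"
    and max: "\<And>B'. right_independent B' \<and> B' \<subseteq> S \<Longrightarrow> card B' \<le> card B"
    using ex_has_greatest_nat[of "\<lambda>B. right_independent B \<and> B \<subseteq> S" "{}" card "Suc (card S)"]
    by blast
  have "S \<subseteq> right_span B"
  proof (rule ccontr)
    assume "\<not> S \<subseteq> right_span B"
    then obtain a where a: "a \<in> S" "a \<notin> right_span B" by blast
    then have "card (insert a B) \<le> card B"
      using B by (intro max) (auto intro: right_independent_insert)
    moreover have "a \<notin> B" using a right_span_base by blast
    ultimately show False using B(2) assms finite_subset by fastforce
  qed
  then have "right_span B = right_span S"
    using right_span_subset_span right_span_mono[OF B(2)] by blast
  with B show ?thesis using that by blast
qed

section \<open>The standard basis\<close>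

lemma right_span_axes: "right_span (range (\<lambda>i. axis i (1::'a::division_ring))) = (UNIV :: ('a ^ 'm) set)"
proof -
  have inj: "inj (\<lambda>i::'m. axis i (1::'a))" by (auto simp: inj_def axis_eq_axis)
  have "x \<in> right_span (range (\<lambda>i. axis i 1))" for x :: "'a ^ 'm"
  proof -
    have "x = (\<Sum>i\<in>UNIV. right_scale (axis i 1) (x $ i))"
      by (simp add: vec_eq_iff right_scale_def axis_def if_distrib[of "\<lambda>z. z * _"] cong: if_cong)
    \<comment> \<open>Spans are sums over vectors, not over indices; \<open>inv\<close> recovers the
      index of a standard basis vector.\<close>
    also have "\<dots> = (\<Sum>v\<in>range (\<lambda>i. axis i 1). right_scale v (x $ (inv (\<lambda>i. axis i 1) v)))"
      by (simp add: sum.reindex[OF inj] inv_f_f[OF inj])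
    finally show ?thesis
      by (subst right_span_iff_finite) auto
  qed
  then show ?thesis by blast
qed

lemma card_axes: "card (range (\<lambda>i::'m::finite. axis i (1::'a::division_ring))) = CARD('m)"
  by (rule card_image) (auto simp: inj_def axis_eq_axis)

text \<open>A basis drawn from the standard vectors must contain each \<open>axis i 1\<close>, for
  without it the span would stay in the hyperplane where coordinate \<open>i\<close>
  vanishes.\<close>

lemma right_independent_axes: "right_independent (range (\<lambda>i::'m::finite. axis i (1::'a::division_ring)))"
proof -
  obtain B where B: "right_independent B" "B \<subseteq> range (\<lambda>i::'m. axis i (1::'a))"
    "right_span B = right_span (range (\<lambda>i::'m. axis i (1::'a)))"
    using right_basis_exists[of "range (\<lambda>i::'m. axis i (1::'a))"] by auto
  have "axis i 1 \<in> B" for i :: 'm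
  proof (rule ccontr)
    assume "axis i 1 \<notin> B"
    have "right_span B \<subseteq> {x. x $ i = 0}"
    proof (rule right_span_minimal)
      show "B \<subseteq> {x. x $ i = 0}"
        using B(2) \<open>axis i 1 \<notin> B\<close> by (auto simp: axis_def)
    qed (auto simp: right_scale_def)
    then have "axis i (1::'a) $ i = 0"
      using B(3) right_span_axes by blast
    then show False by (simp add: axis_def)
  qed
  with B have "B = range (\<lambda>i::'m. axis i (1::'a))" by blast
  with B show ?thesis by simp
qed

lemma right_independent_card_le_CARD:
  assumes "right_independent (B :: ('a::division_ring ^ 'm) set)"
  shows "finite B" "card B \<le> CARD('m)"
  using right_independent_card_le[OF assms, of "range (\<lambda>i. axis i 1)"]
  by (auto simp: right_span_axes card_axes)

section \<open>Idempotents of corank one\<close>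

lemma matrix_vector_mult_right_scale:
  fixes A :: "'a::division_ring ^ 'n ^ 'm"
  shows "A *v right_scale x c = right_scale (A *v x) c"
  by (simp add: matrix_vector_mult_def right_scale_def vec_eq_iff sum_distrib_right mult.assoc)

text \<open>The functional \<phi> of the outline, as a row vector. Its coefficients multiply from
  the left, which makes it linear for right scalars.\<close>

definition row_dot :: "'a::division_ring ^ 'n \<Rightarrow> 'a ^ 'n \<Rightarrow> 'a"
  where "row_dot r x = (\<Sum>i\<in>UNIV. r $ i * x $ i)"

lemma row_dot_algebra:
  fixes x y :: "'a::division_ring ^ 'n"
  shows "row_dot r (x + y) = row_dot r x + row_dot r y"
    and "row_dot r (x - y) = row_dot r x - row_dot r y"
    and "row_dot r (right_scale x c) = row_dot r x * c"
    and "row_dot r 0 = 0"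
  by (simp_all add: row_dot_def right_scale_def algebra_simps sum.distrib sum_subtractf
      sum_distrib_left sum_distrib_right)

text \<open>Column times row: the matrix of the map u \<phi>.\<close>

definition outer :: "'a::division_ring ^ 'm \<Rightarrow> 'a ^ 'n \<Rightarrow> 'a ^ 'n ^ 'm"
  where "outer u r = (\<chi> i j. u $ i * r $ j)"

lemma outer_mult_vec: "outer u r *v x = right_scale u (row_dot r x)"
  by (simp add: outer_def matrix_vector_mult_def right_scale_def row_dot_def vec_eq_iff
      sum_distrib_left mult.assoc)

text \<open>The matrix projects onto the kernel of \<phi> along \<open>u\<close>. Its columns span
  that kernel, and adjoining \<open>u\<close> to any basis of it gives a basis of the whole
  space.\<close>

lemma matrix_rank_id_minus_outer:
  fixes u r :: "'a::division_ring ^ 'n"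
  assumes "row_dot r u = 1"
  shows "matrix_rank (mat 1 - outer u r) = CARD('n) - 1"
proof -
  define E where "E = mat 1 - outer u r"
  have Ev: "E *v x = x - right_scale u (row_dot r x)" for x
    by (simp add: E_def matrix_vector_mult_diff_rdistrib outer_mult_vec)
  have col: "column j E = E *v axis j 1" for j
    by (simp add: column_def matrix_vector_mult_def axis_def vec_eq_iff if_distrib[of "\<lambda>z. _ * z"] cong: if_cong)
  have columns: "columns E = range (\<lambda>j. E *v axis j 1)"
    by (auto simp: columns_def col)
  have span: "right_span (columns E) = {x. row_dot r x = 0}"
  proof
    show "right_span (columns E) \<subseteq> {x. row_dot r x = 0}"
      by (rule right_span_minimal) (auto simp: columns Ev row_dot_algebra assms)
    \<comment> \<open>The vectors that \<open>E\<close> sends into the column span form a right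
      subspace containing the standard basis, hence are all vectors.\<close>
    have "right_span (range (\<lambda>j. axis j 1)) \<subseteq> {x. E *v x \<in> right_span (columns E)}"
    proof (rule right_span_minimal)
      show "range (\<lambda>j. axis j 1) \<subseteq> {x. E *v x \<in> right_span (columns E)}"
        by (auto intro!: right_span_base simp: columns)
    qed (auto simp: matrix_vector_right_distrib matrix_vector_mult_right_scale
        intro: right_span_zero right_span_add right_span_scale)
    then have "E *v x \<in> right_span (columns E)" for x
      by (auto simp: right_span_axes)
    moreover have "E *v x = x" if "row_dot r x = 0" for x
      by (simp add: Ev that)
    ultimately have "x \<in> right_span (columns E)" if "row_dot r x = 0" for x
      using that by metis
    then show "{x. row_dot r x = 0} \<subseteq> right_span (columns E)" by blast
  qed
  \<comment> \<open>\<open>right_dim\<close> takes the size of a basis chosen by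
    \<open>SOME\<close>, so the count is made for every basis.\<close>
  have card: "card B = CARD('n) - 1"
    if B: "right_independent B" "right_span B = right_span (columns E)" for B
  proof -
    have "u \<notin> right_span B" using assms by (simp add: B span)
    then have ind: "right_independent (insert u B)" and "u \<notin> B"
      using B right_independent_insert right_span_base by blast+
    have fin: "finite B" using B right_independent_card_le_CARD by blast
    have "x \<in> right_span (insert u B)" for x
    proof -
      have "E *v x \<in> right_span B" by (simp add: B span Ev row_dot_algebra assms)
      then have "E *v x \<in> right_span (insert u B)" using right_span_mono by blast
      moreover have "right_scale u (row_dot r x) \<in> right_span (insert u B)"
        by (intro right_span_scale right_span_base) simp
      ultimately have "E *v x + right_scale u (row_dot r x) \<in> right_span (insert u B)"
        by (rule right_span_add)
      then show ?thesis by (simp add: Ev)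
    qed
    then have "CARD('n) \<le> card (insert u B)"
      using right_independent_card_le(2)[OF right_independent_axes[where 'm='n and 'a='a], of "insert u B"] fin
      by (auto simp: card_axes)
    moreover have "card (insert u B) \<le> CARD('n)"
      using right_independent_card_le_CARD ind by blast
    ultimately show ?thesis using fin \<open>u \<notin> B\<close> by simp
  qed
  have ex: "\<exists>B. right_independent B \<and> right_span B = right_span (columns E)"
  proof -
    have "finite (columns E)" by (simp add: columns)
    then show ?thesis by (rule right_basis_exists) blast
  qed
  from someI_ex[OF ex]
  have "card (SOME B. right_independent B \<and> right_span B = right_span (columns E)) = CARD('n) - 1"
    by (intro card) auto
  with ex show ?thesis
    unfolding E_def[symmetric] matrix_rank_def right_dim_def by simp
qed

text \<open>\<phi> vanishes on the image of the matrix, so a second application subtracts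
  nothing.\<close>

lemma idempotent_id_minus_outer:
  assumes "row_dot r u = 1"
  shows "idempotent_matrix (mat 1 - outer u r)"
  unfolding idempotent_matrix_def
  by (simp add: matrix_eq matrix_vector_mul_assoc[symmetric] matrix_vector_mult_diff_rdistrib
      outer_mult_vec row_dot_algebra assms)

section \<open>Splitting off one idempotent\<close>

text \<open>A matrix annihilated by \<open>A\<close> yields a nonzero vector in its image; a vector
  \<open>u\<close> yields the matrix \<open>outer u 1\<close>, all of whose columns are
  \<open>u\<close>.\<close>

lemma left_zero_divisor_iff:
  fixes A :: "'a::division_ring ^ 'n ^ 'n"
  shows "left_zero_divisor A \<longleftrightarrow> (\<exists>u. u \<noteq> 0 \<and> A *v u = 0)"
proof
  assume "left_zero_divisor A"
  then obtain B :: "'a ^ 'n ^ 'n" where B: "B \<noteq> 0" "A ** B = 0"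
    by (auto simp: left_zero_divisor_def)
  then obtain x where "B *v x \<noteq> 0"
    by (metis matrix_eq matrix_vector_mult_0)
  moreover have "A *v (B *v x) = 0" by (simp add: matrix_vector_mul_assoc B)
  ultimately show "\<exists>u. u \<noteq> 0 \<and> A *v u = 0" by blast
next
  assume "\<exists>u. u \<noteq> 0 \<and> A *v u = 0"
  then obtain u where u: "u \<noteq> 0" "A *v u = 0" by blast
  have "A ** outer u 1 = 0"
    by (simp add: matrix_eq matrix_vector_mul_assoc[symmetric] outer_mult_vec
        matrix_vector_mult_right_scale u)
  moreover have "outer u 1 \<noteq> (0 :: 'a ^ 'n ^ 'n)"
    using u(1) by (auto simp: outer_def vec_eq_iff)
  ultimately show "left_zero_divisor A" by (auto simp: left_zero_divisor_def)
qed

text \<open>The complementary idempotent \<open>mat 1 - A\<close> is nonzero and annihilates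
  \<open>A\<close> from both sides.\<close>

lemma singular_matrix_idempotent:
  fixes A :: "'a::division_ring ^ 'n ^ 'n"
  assumes "A ** A = A" "A \<noteq> mat 1"
  shows "singular_matrix A"
proof -
  have "A ** (mat 1 - A) = 0" "(mat 1 - A) ** A = 0"
    by (simp_all add: matrix_eq matrix_vector_mul_assoc[symmetric] matrix_vector_mult_diff_rdistrib
        matrix_vector_mult_diff_distrib) (simp_all add: matrix_vector_mul_assoc assms)
  moreover have "mat 1 - A \<noteq> 0" using assms(2) by simp
  ultimately show ?thesis
    unfolding singular_matrix_def left_zero_divisor_def right_zero_divisor_def by blast
qed

text \<open>With \<open>u $ i\<close> and \<open>y $ j\<close> nonzero, one scaled coordinate does
  unless \<open>y $ i\<close> and \<open>u $ j\<close> both vanish; in that case the two scaled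
  coordinates can be added without interfering.\<close>

lemma row_dot_normalise:
  fixes u y :: "'a::division_ring ^ 'n"
  assumes "u \<noteq> 0" "y \<noteq> 0"
  obtains r where "row_dot r u = 1" "row_dot r y \<noteq> 0"
proof -
  have dot: "row_dot (axis k c) z = c * z $ k" for k c and z :: "'a ^ 'n"
    by (simp add: row_dot_def axis_def if_distrib[of "\<lambda>z. z * _"] cong: if_cong)
  have dot_add: "row_dot (r + s) z = row_dot r z + row_dot s z" for r s and z :: "'a ^ 'n"
    by (simp add: row_dot_def algebra_simps sum.distrib)
  obtain i j where ij: "u $ i \<noteq> 0" "y $ j \<noteq> 0" using assms by (auto simp: vec_eq_iff)
  consider "y $ i \<noteq> 0" | "u $ j \<noteq> 0" | "y $ i = 0" "u $ j = 0" by blast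
  then show ?thesis
  proof cases
    case 1
    then show ?thesis using ij by (intro that[of "axis i (inverse (u $ i))"]) (auto simp: dot)
  next
    case 2
    then show ?thesis using ij by (intro that[of "axis j (inverse (u $ j))"]) (auto simp: dot)
  next
    case 3
    then show ?thesis using ij
      by (intro that[of "axis i (inverse (u $ i)) + axis j (inverse (y $ j))"]) (auto simp: dot dot_add)
  qed
qed

lemma singular_matrix_mult_id_plus_outer:
  fixes A :: "'a::division_ring ^ 'n ^ 'n"
  assumes "singular_matrix A" "A *v u = 0" "row_dot r u = 1"
  shows "singular_matrix (A ** (mat 1 + outer z r))"
proof -
  have Pv: "(mat 1 + outer z r) *v v = v + right_scale z (row_dot r v)" for v
    by (simp add: matrix_vector_mult_add_rdistrib outer_mult_vec)
  \<comment> \<open>\<open>1 + z \<phi>\<close> either kills \<open>z\<close>, or is invertible and maps some \<open>v\<close> to the kernel vector \<open>u\<close>.\<close>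
  have "\<exists>v. v \<noteq> 0 \<and> A *v (v + right_scale z (row_dot r v)) = 0"
  proof (cases "1 + row_dot r z = 0")
    case True
    then have m: "row_dot r z = - 1" by (simp add: add_eq_0_iff)
    then have "z \<noteq> 0" by (auto simp: row_dot_algebra)
    then show ?thesis by (intro exI[of _ z]) (simp add: m right_scale_algebra)
  next
    case False
    \<comment> \<open>Here \<open>v\<close> is to solve v + z \<phi>(v) = u. Applying \<phi> gives
      (1 + \<phi>(z)) \<phi>(v) = 1, hence \<phi>(v) = c and v = u - z c.\<close>
    define c where "c = inverse (1 + row_dot r z)"
    define v where "v = u - right_scale z c"
    have c: "c + row_dot r z * c = 1"
      using False right_inverse[OF False] by (simp add: c_def distrib_right)
    have "v + right_scale z (row_dot r v) = u + right_scale z (1 - (c + row_dot r z * c))"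
      by (simp add: v_def row_dot_algebra assms right_scale_algebra)
    then have eq: "v + right_scale z (row_dot r v) = u" by (simp add: c)
    moreover have "u \<noteq> 0" using assms(3) by (auto simp: row_dot_algebra)
    ultimately have "v \<noteq> 0" by (auto simp: row_dot_algebra)
    with eq show ?thesis using assms(2) by auto
  qed
  then have "left_zero_divisor (A ** (mat 1 + outer z r))"
    by (simp add: left_zero_divisor_iff matrix_vector_mul_assoc[symmetric] Pv)
  \<comment> \<open>A matrix that annihilates \<open>A\<close> from the left also annihilates every
    product \<open>A ** P\<close> from the left.\<close>
  moreover have "right_zero_divisor (A ** (mat 1 + outer z r))"
    using assms(1) unfolding singular_matrix_def right_zero_divisor_def
    by (metis matrix_mul_assoc times0_left)
  ultimately show ?thesis by (simp add: singular_matrix_def)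
qed

text \<open>The witness is the row vector r M; this represents \<theta> (1 - A) as a
  \<open>row_dot\<close>.\<close>

lemma row_dot_comp_matrix:
  fixes M :: "'a::division_ring ^ 'n ^ 'm"
  obtains s where "\<And>v. row_dot s v = row_dot r (M *v v)"
proof
  fix v
  have "row_dot r (M *v v) = (\<Sum>i\<in>UNIV. \<Sum>j\<in>UNIV. r $ i * M $ i $ j * v $ j)"
    by (simp add: row_dot_def matrix_vector_mult_def sum_distrib_left mult.assoc)
  also have "\<dots> = (\<Sum>j\<in>UNIV. \<Sum>i\<in>UNIV. r $ i * M $ i $ j * v $ j)" by (rule sum.swap)
  finally show "row_dot (\<chi> j. \<Sum>i\<in>UNIV. r $ i * M $ i $ j) v = row_dot r (M *v v)"
    by (simp add: row_dot_def sum_distrib_right)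
qed

lemma split_off_idempotent:
  fixes A :: "'a::division_ring ^ 'n ^ 'n"
  assumes sing: "singular_matrix A"
    and not_corank1: "\<nexists>u r. row_dot r u = 1 \<and> A = mat 1 - outer u r"
  obtains A' u r x where "singular_matrix A'" "row_dot r u = 1" "A = A' ** (mat 1 - outer u r)"
    "\<And>v. A *v v = v \<Longrightarrow> A' *v v = v" "A' *v x = x" "A *v x \<noteq> x"
proof -
  obtain u where u: "u \<noteq> 0" "A *v u = 0"
    using sing by (auto simp: singular_matrix_def left_zero_divisor_iff)
  have sub: "(mat 1 - A) *v v = v - A *v v" for v
    by (simp add: matrix_vector_mult_diff_rdistrib)
  have Ev: "(mat 1 - outer u r) *v v = v - right_scale u (row_dot r v)" for r v
    by (simp add: matrix_vector_mult_diff_rdistrib outer_mult_vec)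
  show ?thesis
  proof (cases "A ** A = A")
    case True
    have AA: "A *v (A *v v) = A *v v" for v by (simp add: matrix_vector_mul_assoc True)
    obtain t where t: "row_dot t u = 1" using row_dot_normalise[OF u(1) u(1)] by blast
    \<comment> \<open>\<phi> vanishes on the vectors fixed by \<open>A\<close>, which for an
      idempotent include its whole image, so \<phi> A = 0. As A u = 0, \<phi> and \<open>t\<close>
      agree at \<open>u\<close>.\<close>
    obtain r where r: "\<And>v. row_dot r v = row_dot t (v - A *v v)"
      using row_dot_comp_matrix[of t "mat 1 - A"] by (auto simp: sub)
    have ru: "row_dot r u = 1" and rA: "\<And>v. row_dot r (A *v v) = 0"
      by (simp_all add: r u t AA row_dot_algebra)
    define A' where "A' = A + outer u r"
    have A'v: "A' *v v = A *v v + right_scale u (row_dot r v)" for v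
      by (simp add: A'_def matrix_vector_mult_add_rdistrib outer_mult_vec)
    \<comment> \<open>The cross terms of the square vanish by A u = 0 and \<phi> A = 0, and u \<phi>
      is idempotent by \<phi> u = 1.\<close>
    have "A' ** A' = A'"
      by (simp add: matrix_eq matrix_vector_mul_assoc[symmetric] A'v matrix_vector_right_distrib
          matrix_vector_mult_right_scale AA u row_dot_algebra rA ru)
    moreover have "A' \<noteq> mat 1"
    proof
      assume "A' = mat 1"
      then have "A = mat 1 - outer u r" unfolding A'_def by (metis add_diff_cancel_right')
      with ru not_corank1 show False by blast
    qed
    ultimately have "singular_matrix A'" by (rule singular_matrix_idempotent)
    moreover have "A = A' ** (mat 1 - outer u r)"
      by (simp add: matrix_eq matrix_vector_mul_assoc[symmetric] Ev A'v
          matrix_vector_mult_diff_distrib matrix_vector_mult_right_scale u row_dot_algebra ru)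
    moreover have "A' *v v = v" if "A *v v = v" for v
      by (simp add: A'v that r row_dot_algebra)
    moreover have "A' *v u = u" "A *v u \<noteq> u" using u by (auto simp: A'v ru)
    ultimately show ?thesis using that ru by blast
  next
    case False
    then obtain y0 where "A *v (A *v y0) \<noteq> A *v y0"
      by (auto simp: matrix_eq matrix_vector_mul_assoc[symmetric])
    then have "A *v y0 - A *v (A *v y0) \<noteq> 0" by simp
    \<comment> \<open>The second condition says \<phi>(A y0) \<noteq> 0, so that \<phi> can be
      normalised to 1 on a vector in the image of \<open>A\<close>.\<close>
    then obtain t where t: "row_dot t u = 1" "row_dot t (A *v y0 - A *v (A *v y0)) \<noteq> 0"
      using row_dot_normalise u(1) by blast
    obtain r where r: "\<And>v. row_dot r v = row_dot t (v - A *v v)"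
      using row_dot_comp_matrix[of t "mat 1 - A"] by (auto simp: sub)
    define y where "y = right_scale y0 (inverse (row_dot r (A *v y0)))"
    define x where "x = A *v y"
    have ru: "row_dot r u = 1" by (simp add: r u t)
    have rx: "row_dot r x = 1"
      using t(2) by (simp add: x_def y_def matrix_vector_mult_right_scale row_dot_algebra(3) r[of "A *v y0"])
    \<comment> \<open>Since A y = x, this is A + w \<phi> with w = x - A x.\<close>
    define A' where "A' = A ** (mat 1 + outer (y - x) r)"
    have A'v: "A' *v v = A *v v + right_scale (x - A *v x) (row_dot r v)" for v
      by (simp add: A'_def matrix_vector_mul_assoc[symmetric] matrix_vector_mult_add_rdistrib
          outer_mult_vec matrix_vector_right_distrib matrix_vector_mult_right_scale
          matrix_vector_mult_diff_distrib x_def)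
    have "singular_matrix A'"
      unfolding A'_def using sing u(2) ru by (rule singular_matrix_mult_id_plus_outer)
    moreover have "A = A' ** (mat 1 - outer u r)"
      by (simp add: matrix_eq matrix_vector_mul_assoc[symmetric] Ev A'v
          matrix_vector_mult_diff_distrib matrix_vector_mult_right_scale u row_dot_algebra ru)
    moreover have "A' *v v = v" if "A *v v = v" for v
      by (simp add: A'v that r row_dot_algebra)
    moreover have "A' *v x = x" by (simp add: A'v rx)
    \<comment> \<open>\<phi> would vanish at a vector fixed by \<open>A\<close>, but it is 1 at
      \<open>x\<close>.\<close>
    moreover have "A *v x \<noteq> x" using rx by (auto simp: r row_dot_algebra)
    ultimately show ?thesis using that ru by blast
  qed
qed

section \<open>Chains of fixed spaces\<close>

text \<open>Reduces the preorder on matrices to fixed vectors, taken from the image of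
  \<open>X\<close>.\<close>

lemma r_Fix_iff: "X \<in> r_Fix A \<longleftrightarrow> (\<forall>v. A *v (X *v v) = X *v v)"
  by (simp add: r_Fix_def matrix_eq matrix_vector_mul_assoc)

lemma r_Fix_lessI:
  fixes A A' :: "'a::division_ring ^ 'n ^ 'n"
  assumes "\<And>v. A *v v = v \<Longrightarrow> A' *v v = v" "A' *v x = x" "A *v x \<noteq> x"
  shows "r_Fix_less A' A"
proof -
  \<comment> \<open>Every column of \<open>X\<close> is \<open>x\<close>, so \<open>X\<close>
    detects whether \<open>x\<close> is fixed.\<close>
  define X :: "'a ^ 'n ^ 'n" where "X = outer x 1"
  have "X \<in> r_Fix A'"
    by (simp add: r_Fix_iff X_def outer_mult_vec matrix_vector_mult_right_scale assms)
  moreover have "X \<notin> r_Fix A"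
  proof
    assume "X \<in> r_Fix A"
    \<comment> \<open>The index is arbitrary: \<open>X\<close> sends each standard basis vector to
      \<open>x\<close>.\<close>
    then have "A *v (X *v axis undefined 1) = X *v axis undefined 1"
      by (simp add: r_Fix_iff)
    moreover have "row_dot 1 (axis (undefined :: 'n) 1) = (1 :: 'a)"
      by (simp add: row_dot_def axis_def)
    ultimately show False
      using assms(3) by (simp add: X_def outer_mult_vec)
  qed
  moreover have "r_Fix A \<subseteq> r_Fix A'" using assms(1) by (auto simp: r_Fix_iff)
  ultimately show ?thesis by (auto simp: r_Fix_less_def r_Fix_le_def)
qed

text \<open>The identity is not a zero divisor, so removing it from \<open>R_sharp\<close> discards
  no singular matrix.\<close>

lemma singular_matrix_iff_nonunit:
  "singular_matrix A \<longleftrightarrow> A \<in> r_Fix_nonunits"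
  by (auto simp: singular_matrix_def r_Fix_nonunits_def R_sharp_def left_zero_divisor_def)

text \<open>The condition under the supremum in \<open>r_Fix_height\<close>, with \<open>C\<close>
  kept explicit so that a chain can be extended at its head.\<close>

definition r_Fix_chain :: "'a::division_ring ^ 'n ^ 'n \<Rightarrow> nat \<Rightarrow> (nat \<Rightarrow> 'a ^ 'n ^ 'n) \<Rightarrow> bool"
  where "r_Fix_chain A m C \<longleftrightarrow> 1 \<le> m \<and> (\<forall>k\<in>{1..m}. C k \<in> r_Fix_nonunits) \<and> C 1 = A \<and>
    (\<forall>k\<in>{1..<m}. r_Fix_less (C (k + 1)) (C k))"

lemma r_Fix_chain_height_le: "r_Fix_chain A m C \<Longrightarrow> enat m \<le> r_Fix_height A"
  unfolding r_Fix_height_def r_Fix_chain_def by (rule Sup_upper) blast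

text \<open>Positions count from 1: \<open>A\<close> takes position 1 and the old chain shifts up by
  one.\<close>

lemma r_Fix_chain_Cons:
  assumes "r_Fix_chain A' m C" "A \<in> r_Fix_nonunits" "r_Fix_less A' A"
  shows "r_Fix_chain A (Suc m) (\<lambda>k. if k = 1 then A else C (k - 1))"
  unfolding r_Fix_chain_def
proof (intro conjI ballI)
  fix k assume k: "k \<in> {1..<Suc m}"
  show "r_Fix_less (if k + 1 = 1 then A else C (k + 1 - 1)) (if k = 1 then A else C (k - 1))"
  proof (cases "k = 1")
    case True
    then show ?thesis using assms by (simp add: r_Fix_chain_def)
  next
    case False
    then have "k - 1 \<in> {1..<m}" "k - 1 + 1 = k" using k by auto
    then have "r_Fix_less (C k) (C (k - 1))"
      using assms(1) unfolding r_Fix_chain_def by metis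
    then show ?thesis using False k by simp
  qed
next
  fix k assume "k \<in> {1..Suc m}"
  then have "k = 1 \<or> k - 1 \<in> {1..m}" by auto
  then show "(if k = 1 then A else C (k - 1)) \<in> r_Fix_nonunits"
    using assms(1,2) by (auto simp: r_Fix_chain_def)
qed auto

text \<open>Factors are split off on the right, whereas \<open>foldr\<close> unfolds from the
  left.\<close>

lemma matrix_prod_list_snoc: "matrix_prod_list (Es @ [E]) = matrix_prod_list Es ** E"
  by (induction Es) (auto simp: matrix_prod_list_def matrix_mul_assoc)

text \<open>The independent set \<open>B\<close> of vectors fixed by \<open>A\<close> measures
  progress: each step adjoins an \<open>x\<close> that \<open>A'\<close> fixes and \<open>A\<close>
  does not, so \<open>CARD('n) - card B\<close> decreases.\<close>

lemma idempotent_factorization_chain: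
  fixes A :: "'a::division_ring ^ 'n ^ 'n"
  assumes "singular_matrix A" "right_independent B" "\<forall>b\<in>B. A *v b = b"
  shows "\<exists>Es C. r_Fix_chain A (length Es) C \<and>
    (\<forall>E\<in>set Es. idempotent_matrix E \<and> matrix_rank E = CARD('n) - 1) \<and>
    A = matrix_prod_list Es"
  using assms
proof (induction "CARD('n) - card B" arbitrary: A B rule: less_induct)
  case less
  show ?case
  proof (cases "\<exists>u r. row_dot r u = 1 \<and> A = mat 1 - outer u r")
    case True
    then have "idempotent_matrix A \<and> matrix_rank A = CARD('n) - 1"
      using idempotent_id_minus_outer matrix_rank_id_minus_outer by blast
    moreover have "r_Fix_chain A (length [A]) (\<lambda>_. A)"
      using less.prems(1) by (simp add: r_Fix_chain_def singular_matrix_iff_nonunit)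
    ultimately show ?thesis
      by (intro exI[of _ "[A]"] exI[of _ "\<lambda>_. A"]) (simp add: matrix_prod_list_def)
  next
    case False
    obtain A' u r x where A': "singular_matrix A'" "row_dot r u = 1"
        "A = A' ** (mat 1 - outer u r)"
      and fixed: "\<And>v. A *v v = v \<Longrightarrow> A' *v v = v" "A' *v x = x" "A *v x \<noteq> x"
      using split_off_idempotent[OF less.prems(1) False] by metis
    \<comment> \<open>The vectors fixed by \<open>A\<close> form a right subspace, so its whole span
      is fixed and cannot contain \<open>x\<close>.\<close>
    have "right_span B \<subseteq> {v. A *v v = v}"
      by (rule right_span_minimal)
        (use less.prems(3) in \<open>auto simp: matrix_vector_right_distrib matrix_vector_mult_right_scale\<close>)
    with fixed(3) have xB: "x \<notin> right_span B" by blast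
    then have ind: "right_independent (insert x B)"
      using less.prems(2) by (rule right_independent_insert[rotated])
    have "x \<notin> B" using xB right_span_base by blast
    then have "card (insert x B) = Suc (card B)"
      using right_independent_card_le_CARD(1)[OF less.prems(2)] by simp
    \<comment> \<open>This bound makes the truncated difference drop strictly.\<close>
    moreover have "card (insert x B) \<le> CARD('n)"
      by (rule right_independent_card_le_CARD[OF ind])
    ultimately have "CARD('n) - card (insert x B) < CARD('n) - card B" by linarith
    moreover have "\<forall>b\<in>insert x B. A' *v b = b" using fixed less.prems(3) by auto
    ultimately obtain Es C where Es: "r_Fix_chain A' (length Es) C"
        "\<forall>E\<in>set Es. idempotent_matrix E \<and> matrix_rank E = CARD('n) - 1"
        "A' = matrix_prod_list Es"
      using less.hyps A'(1) ind by blast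
    \<comment> \<open>The new factor goes to the end of the list and \<open>A\<close> to the head of
      the chain, so the two lengths stay equal.\<close>
    have "r_Fix_chain A (length (Es @ [mat 1 - outer u r])) (\<lambda>k. if k = 1 then A else C (k - 1))"
      using r_Fix_chain_Cons[OF Es(1) _ r_Fix_lessI[OF fixed]] less.prems(1)
      by (simp add: singular_matrix_iff_nonunit)
    moreover have "A = matrix_prod_list (Es @ [mat 1 - outer u r])"
      using A'(3) by (simp add: matrix_prod_list_snoc Es(3))
    moreover have "\<forall>E\<in>set (Es @ [mat 1 - outer u r]).
        idempotent_matrix E \<and> matrix_rank E = CARD('n) - 1"
      using Es(2) A'(2) by (simp add: idempotent_id_minus_outer matrix_rank_id_minus_outer)
    ultimately show ?thesis by blast
  qed
qed

theorem proposition5p9: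
  fixes A :: "'a::division_ring ^ 'n ^ 'n"
  assumes "singular_matrix A"
  shows "\<exists>Es :: ('a ^ 'n ^ 'n) list.
    enat (length Es) \<le> r_Fix_height A \<and>
    (\<forall>E\<in>set Es. idempotent_matrix E \<and> matrix_rank E = CARD('n) - 1) \<and>
    A = matrix_prod_list Es"
  \<comment> \<open>The induction starts from the empty set of fixed vectors.\<close>
  using idempotent_factorization_chain[OF assms, of "{}"] r_Fix_chain_height_le
  by (auto simp: right_independent_def)

end
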